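(* Let $t$ be a fixed positive integer. Assume that $\alpha,\beta,q$ are complex variables with $|q|<1$, $q\neq 0$, $\alpha\neq\beta q$ and $(\beta q;q)_t\neq 0$. Define $$S(\alpha,\beta;q;t):=\sum_{r\ge 1}\frac{(1-\alpha q^{r})(1-\alpha q^{r+1})\cdots(1-\alpha q^{r+t-2})}{(1-\beta q^{r})(1-\beta q^{r+1})\cdots(1-\beta q^{r+t})}\,q^r,$$ where the numerator is the product of the $t-1$ factors $1-\alpha q^{r+i}$, $0\le i\le t-2$ (the empty product $1$ if $t=1$), and the denominator is the product of the $t+1$ factors $1-\beta q^{r+i}$, $0\le i\le t$. Then $$S(\alpha,\beta;q;t)=\frac{q}{(\beta q-\alpha)(1-q^t)}\left(\frac{(\alpha;q)_t}{(\beta q;q)_t}-1\right).$$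
   Context: The $q$-Pochhammer symbol is $(a;q)_n:=\prod_{k=0}^{n-1}(1-aq^k)$ for $|q|<1$.
   Formalization: Adds the assumption that no denominator factor 1−βq^(r+i) (r≥1, 0≤i≤t) vanishes; the stated (βq;q)_t≠0 alone leaves S undefined, e.g. at β=q^(−t−1). *)

theory Defs
  imports Complex_Main
begin

definition qpoch :: "complex \<Rightarrow> complex \<Rightarrow> nat \<Rightarrow> complex" where
  "qpoch a q n = (\<Prod>k<n. 1 - a * q ^ k)"

(* Meant for t > 0. *)
definition S_term :: "complex \<Rightarrow> complex \<Rightarrow> complex \<Rightarrow> nat \<Rightarrow> nat \<Rightarrow> complex" where
  "S_term \<alpha> \<beta> q t r =
     (\<Prod>i<t - 1. 1 - \<alpha> * q ^ (r + i)) / (\<Prod>i\<le>t. 1 - \<beta> * q ^ (r + i)) * q ^ r"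

(* The sum is over r \<ge> 1, hence the shift by Suc. *)
definition S :: "complex \<Rightarrow> complex \<Rightarrow> complex \<Rightarrow> nat \<Rightarrow> complex" where
  "S \<alpha> \<beta> q t = (\<Sum>n. S_term \<alpha> \<beta> q t (Suc n))"

end

theory Submission
  imports Defs
begin

text \<open>
  The series telescopes: with \<open>U n = (\<alpha> q\<^sup>n; q)\<^sub>t / (\<beta> q\<^sup>n\<^sup>+\<^sup>1; q)\<^sub>t\<close>, the summand of index \<open>n + 1\<close> is
  a constant multiple of \<open>U n - U (n + 1)\<close>, and \<open>U n\<close> tends to \<open>1\<close>.
\<close>

lemma qpoch_rec: "qpoch a q (Suc n) = (1 - a) * qpoch (a * q) q n"
  by (simp add: qpoch_def prod.lessThan_Suc_shift mult.assoc del: prod.lessThan_Suc)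

lemma qpoch_Suc: "qpoch a q (Suc n) = qpoch a q n * (1 - a * q ^ n)"
  by (simp add: qpoch_def)

lemma S_term_eq_qpoch:
  "S_term \<alpha> \<beta> q t r = qpoch (\<alpha> * q ^ r) q (t - 1) / qpoch (\<beta> * q ^ r) q (Suc t) * q ^ r"
  by (simp add: S_term_def qpoch_def lessThan_Suc_atMost power_add mult.assoc del: prod.lessThan_Suc)

text \<open>Both quotients share the inner products \<open>A\<close> and \<open>B\<close> of length
  \<open>m\<close>. Over the common denominator only the end factors differ, and with
  \<open>Q = q ^ Suc m\<close> the claim becomes \<open>(1 - a) * (1 - b * Q) - (1 - a * Q) * (1 -
  b) = (b - a) * (1 - Q)\<close>.\<close>

lemma qpoch_quotient_diff:
  assumes "qpoch b q (Suc (Suc m)) \<noteq> 0"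
  shows "qpoch a q (Suc m) / qpoch b q (Suc m) - qpoch (a * q) q (Suc m) / qpoch (b * q) q (Suc m) =
    (b - a) * (1 - q ^ Suc m) * (qpoch (a * q) q m / qpoch b q (Suc (Suc m)))"
proof -
  define A where "A = qpoch (a * q) q m"
  define B where "B = qpoch (b * q) q m"
  have nz: "B \<noteq> 0" "1 - b \<noteq> 0" "1 - b * q ^ Suc m \<noteq> 0"
    using assms by (auto simp: B_def qpoch_rec[of b] qpoch_Suc[of "b * q"] mult.assoc)
  have eqs: "qpoch a q (Suc m) = (1 - a) * A" "qpoch b q (Suc m) = (1 - b) * B"
    "qpoch (a * q) q (Suc m) = A * (1 - a * q ^ Suc m)"
    "qpoch (b * q) q (Suc m) = B * (1 - b * q ^ Suc m)"
    "qpoch b q (Suc (Suc m)) = (1 - b) * B * (1 - b * q ^ Suc m)"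
    by (simp_all add: A_def B_def qpoch_rec[of a] qpoch_rec[of b] qpoch_Suc[of "a * q"]
        qpoch_Suc[of "b * q"] mult.assoc)
  show ?thesis
    unfolding eqs A_def[symmetric] using nz
    \<comment> \<open>Without \<open>power_Suc\<close>, \<open>q ^ Suc m\<close> stays atomic and
      the goal is a polynomial identity.\<close>
    by (simp add: divide_simps del: power_Suc) (simp add: algebra_simps del: power_Suc)
qed

lemma qpoch_tendsto_1:
  assumes "(f \<longlongrightarrow> 0) F"
  shows "((\<lambda>n. qpoch (f n) q t) \<longlongrightarrow> 1) F"
proof -
  have "((\<lambda>n. \<Prod>k<t. 1 - f n * q ^ k) \<longlongrightarrow> (\<Prod>k<t. 1 - 0 * q ^ k)) F"
    by (intro tendsto_intros assms)
  then show ?thesis by (simp add: qpoch_def)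
qed

theorem theorem1p2:
  fixes \<alpha> \<beta> q :: complex and t :: nat
  assumes "t > 0"
    and "norm q < 1" and "q \<noteq> 0"
    and "\<alpha> \<noteq> \<beta> * q"
    and "qpoch (\<beta> * q) q t \<noteq> 0"
    and terms_defined: "\<And>r i. r \<ge> 1 \<Longrightarrow> i \<le> t \<Longrightarrow> 1 - \<beta> * q ^ (r + i) \<noteq> 0"
  shows "summable (\<lambda>n. S_term \<alpha> \<beta> q t (Suc n)) \<and>
         S \<alpha> \<beta> q t =
           q / ((\<beta> * q - \<alpha>) * (1 - q ^ t)) * (qpoch \<alpha> q t / qpoch (\<beta> * q) q t - 1)"
proof -
  obtain m where t: "t = Suc m"
    using \<open>t > 0\<close> gr0_implies_Suc by blast
  define U where "U n = qpoch (\<alpha> * q ^ n) q t / qpoch (\<beta> * q ^ Suc n) q t" for n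
  \<comment> \<open>Chosen to cancel the constant factor of \<open>U n - U (Suc n)\<close> and leave
    \<open>q\<close>, which turns the remaining \<open>q ^ n\<close> into the
    \<open>q ^ Suc n\<close> of the summand.\<close>
  define c where "c = q / ((\<beta> * q - \<alpha>) * (1 - q ^ t))"
  have "norm (q ^ t) < 1"
    using \<open>t > 0\<close> \<open>norm q < 1\<close> by (simp add: norm_power power_less_one_iff)
  then have "q ^ t \<noteq> 1" by force
  have step: "S_term \<alpha> \<beta> q t (Suc n) = c * (U n - U (Suc n))" for n
  proof -
    have "qpoch (\<beta> * q ^ Suc n) q (Suc t) \<noteq> 0"
      using terms_defined[of "Suc n"] unfolding qpoch_def
      by (simp add: less_Suc_eq_le power_add mult.assoc del: prod.lessThan_Suc)
    \<comment> \<open>Here \<open>a\<close> is \<open>\<alpha> * q ^ n\<close> and \<open>b\<close>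
      is \<open>\<beta> * q ^ Suc n\<close>, one power ahead, so \<open>b - a\<close> is a constant
      times \<open>q ^ n\<close>.\<close>
    from qpoch_quotient_diff[OF this[unfolded t], of "\<alpha> * q ^ n"]
    have "U n - U (Suc n) = (\<beta> * q ^ Suc n - \<alpha> * q ^ n) * (1 - q ^ t) *
        (qpoch (\<alpha> * q ^ Suc n) q m / qpoch (\<beta> * q ^ Suc n) q (Suc t))"
      by (simp add: U_def t mult_ac)
    also have "\<beta> * q ^ Suc n - \<alpha> * q ^ n = (\<beta> * q - \<alpha>) * q ^ n"
      by (simp add: algebra_simps)
    finally have "c * (U n - U (Suc n)) = (c * ((\<beta> * q - \<alpha>) * (1 - q ^ t))) * q ^ n *
        (qpoch (\<alpha> * q ^ Suc n) q m / qpoch (\<beta> * q ^ Suc n) q (Suc t))"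
      by (simp only: mult_ac)
    also have "c * ((\<beta> * q - \<alpha>) * (1 - q ^ t)) = q"
      using \<open>\<alpha> \<noteq> \<beta> * q\<close> \<open>q ^ t \<noteq> 1\<close> by (simp add: c_def)
    finally show ?thesis
      by (simp add: S_term_eq_qpoch t)
  qed
  have lim: "(\<lambda>n. a * q ^ n) \<longlonglongrightarrow> 0" for a
    using tendsto_mult_right_zero[OF LIMSEQ_power_zero[OF \<open>norm q < 1\<close>]] .
  \<comment> \<open>Numerator and denominator are products of fixed length \<open>t\<close> whose
    parameters tend to 0. The form \<open>1 / 1\<close> matches
    \<open>tendsto_divide\<close>.\<close>
  have "U \<longlonglongrightarrow> 1 / 1"
    unfolding U_def
    by (intro tendsto_divide qpoch_tendsto_1 lim LIMSEQ_Suc[OF lim]) simp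
  \<comment> \<open>The differences \<open>U n - U (Suc n)\<close> sum to \<open>U 0 - 1\<close>;
    the \<open>sums\<close> form yields summability and the value together.\<close>
  from sums_mult[OF telescope_sums'[OF this], of c]
  have "(\<lambda>n. S_term \<alpha> \<beta> q t (Suc n)) sums (c * (U 0 - 1))"
    by (simp add: step)
  then show ?thesis
    unfolding S_def by (auto simp: sums_iff U_def c_def)
qed

end
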